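(* Let $a<\mu<b$, $d>0$, and let $\mathcal{P}_{(\mu,d)}$ be the set of probability distributions supported on (a subset of) $[a,b]$ with mean $\mu$ and mean absolute deviation from the mean $\mathbb{E}|X-\mu|=d$, assumed nonempty. Let $t\le b$. For a real-valued random variable $X$ with distribution $\mathbb{P}\in\mathcal{P}_{(\mu,d)}$, it holds that $$\sup_{\mathbb{P}\in\mathcal{P}_{(\mu,d)}}\mathbb{E}_{\mathbb{P}}[X\mid X\ge t]=\begin{cases}\mu+\dfrac{d(\mu-t)}{2(\mu-t)-d},&\text{for }t<\mu-\dfrac{d(b-\mu)}{2(b-\mu)-d},\\[3mm] b,&\text{for }t\ge\mu-\dfrac{d(b-\mu)}{2(b-\mu)-d}.\end{cases}$$
   Context: The conditional expectation is $\mathbb{E}_{\mathbb{P}}[X\mid X\ge t]=\mathbb{E}_{\mathbb{P}}[X\mathbf{1}_{\{X\ge t\}}]/\mathbb{P}(X\ge t)$, and the supremum is taken over those $\mathbb{P}$ in the set for which $\mathbb{P}(X\ge t)>0$. The supremum need not be attained.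
   Formalization: The formal statement additionally assumes a < t; for every t ≤ a the conditional expectation equals μ for all distributions in the set, while the stated formula gives a value above μ (e.g. a=-1, μ=0, b=1, d=1/2, t=-1: supremum 0, formula 1/3). *)

theory Defs
  imports "HOL-Probability.Probability"
begin

text \<open>
  Laws on the real line concentrated on the closed interval \<open>[a, b]\<close>, with mean \<open>\<mu>\<close> and mean
  absolute deviation \<open>d\<close>. A random variable enters only through its law, so \<open>X\<close> is the identity
  on the real line. Integrability is automatic because the support is bounded.
\<close>

definition mean_mad_set :: "real \<Rightarrow> real \<Rightarrow> real \<Rightarrow> real \<Rightarrow> real measure set" where
  "mean_mad_set a b \<mu> d =
     {P. real_distribution P \<and> measure P {a..b} = 1 \<and>
         (\<integral>x. x \<partial>P) = \<mu> \<and> (\<integral>x. \<bar>x - \<mu>\<bar> \<partial>P) = d}"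

text \<open>Meaningful only if \<open>measure P {t..} > 0\<close>; otherwise the value is the junk value \<open>0\<close>.\<close>

definition cond_expectation_ge :: "real measure \<Rightarrow> real \<Rightarrow> real" where
  "cond_expectation_ge P t = (\<integral>x. x * indicator {t..} x \<partial>P) / measure P {t..}"

end

theory Submission
  imports Defs
begin

text \<open>
  Write \<open>v p = \<mu> + d (\<mu> - p) / (2 (\<mu> - p) - d)\<close>. A law on two points \<open>p < \<mu> < v\<close> with mean \<open>\<mu>\<close>
  splits the deviation evenly: each atom contributes \<open>d / 2\<close>. This determines both the weight of
  the lower atom, \<open>d / (2 (\<mu> - p))\<close>, and the position of the upper one, \<open>v = v p\<close>. Such a law is
  admissible as soon as \<open>a \<le> p\<close> and \<open>v p \<le> b\<close>, and if \<open>p < t \<le> v p\<close>, then conditioning on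
  \<open>X \<ge> t\<close> discards the lower atom, so that the conditional mean is \<open>v p\<close>.

  The point \<open>T = \<mu> - d (b - \<mu>) / (2 (b - \<mu>) - d)\<close> is where \<open>v T = b\<close>, and it lies in \<open>[a, \<mu>)\<close>
  because the class is nonempty (\<open>mad_le_chord\<close>). For \<open>t > T\<close> the law on \<open>{T, b}\<close> attains
  the trivial upper bound \<open>b\<close>. For \<open>t \<le> T\<close> the lower atom has to stay strictly below \<open>t\<close>, and
  letting \<open>p\<close> increase to \<open>t\<close> gives the lower bound \<open>v t\<close>, which is \<open>b\<close> for \<open>t = T\<close>. This is why
  the supremum need not be attained.

  The bound \<open>v t\<close> for \<open>t < T\<close> is optimal by duality: \<open>(x - v t) 1{x \<ge> t}\<close> is dominated by
  a combination of \<open>x - \<mu>\<close> and \<open>\<bar>x - \<mu>\<bar> - d\<close>, both of which integrate to \<open>0\<close> under every law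
  of the class (\<open>cond_expectation_ge_dual_bound\<close> and \<open>upper_atom_dual_certificate\<close>).
\<close>

section \<open>Laws with prescribed mean and mean absolute deviation\<close>

lemma mean_mad_set_AE:
  assumes "P \<in> mean_mad_set a b \<mu> d"
  shows "AE x in P. a \<le> x \<and> x \<le> b"
proof -
  interpret real_distribution P using assms by (simp add: mean_mad_set_def)
  have "prob {a..b} = 1" using assms by (simp add: mean_mad_set_def)
  then have "AE x in P. x \<in> {a..b}" by (rule AE_prob_1)
  then show ?thesis by simp
qed

lemma mean_mad_set_integrable:
  assumes "P \<in> mean_mad_set a b \<mu> d"
  shows "integrable P (\<lambda>x. x)"
proof -
  interpret real_distribution P using assms by (simp add: mean_mad_set_def)
  have "AE x in P. norm x \<le> max \<bar>a\<bar> \<bar>b\<bar>"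
    using mean_mad_set_AE[OF assms] by eventually_elim auto
  then show ?thesis by (rule integrable_const_bound) simp
qed

text \<open>
  The chord of the convex function \<open>\<bar>x - \<mu>\<bar>\<close> over \<open>[a, b]\<close> lies above it, and the chord is affine,
  so its expectation depends on the mean only.
\<close>

lemma mad_le_chord:
  assumes P: "P \<in> mean_mad_set a b \<mu> d" and "a < \<mu>" "\<mu> < b"
  shows "d * (b - a) \<le> 2 * (\<mu> - a) * (b - \<mu>)"
proof -
  interpret real_distribution P using P by (simp add: mean_mad_set_def)
  note [simp] = mean_mad_set_integrable[OF P]
  have mean: "(\<integral>x. x \<partial>P) = \<mu>" and mad: "(\<integral>x. \<bar>x - \<mu>\<bar> \<partial>P) = d"
    using P by (simp_all add: mean_mad_set_def)
  have chord: "\<bar>x - \<mu>\<bar> * (b - a) \<le> (b - x) * (\<mu> - a) + (x - a) * (b - \<mu>)"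
    if "a \<le> x" "x \<le> b" for x
  proof (cases "x \<le> \<mu>")
    case True
    have "0 \<le> 2 * ((x - a) * (b - \<mu>))" using that assms by simp
    also have "\<dots> = (b - x) * (\<mu> - a) + (x - a) * (b - \<mu>) - \<bar>x - \<mu>\<bar> * (b - a)"
      using True by (simp add: algebra_simps)
    finally show ?thesis by simp
  next
    case False
    have "0 \<le> 2 * ((b - x) * (\<mu> - a))" using that assms by simp
    also have "\<dots> = (b - x) * (\<mu> - a) + (x - a) * (b - \<mu>) - \<bar>x - \<mu>\<bar> * (b - a)"
      using False by (simp add: algebra_simps)
    finally show ?thesis by simp
  qed
  have "d * (b - a) = (\<integral>x. \<bar>x - \<mu>\<bar> * (b - a) \<partial>P)"
    by (simp add: mad)
  also have "\<dots> \<le> (\<integral>x. (b - x) * (\<mu> - a) + (x - a) * (b - \<mu>) \<partial>P)"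
  proof (rule integral_mono_AE)
    show "AE x in P. \<bar>x - \<mu>\<bar> * (b - a) \<le> (b - x) * (\<mu> - a) + (x - a) * (b - \<mu>)"
      using mean_mad_set_AE[OF P] by eventually_elim (use chord in blast)
  qed simp_all
  also have "\<dots> = 2 * (\<mu> - a) * (b - \<mu>)"
    by (simp add: mean prob_space[simplified] algebra_simps)
  finally show ?thesis .
qed

section \<open>Upper bounds by duality\<close>

text \<open>
  Weak duality: \<open>\<alpha>\<close> and \<open>\<beta>\<close> are the multipliers of the two moment constraints, whose contribution
  vanishes after integration. That leaves \<open>E[(X - c) 1{X \<ge> t}] \<le> 0\<close>, which is the claim after
  division by \<open>P(X \<ge> t)\<close>.
\<close>

lemma cond_expectation_ge_dual_bound:
  assumes P: "P \<in> mean_mad_set a b \<mu> d" and pos: "measure P {t..} > 0"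
    and dual: "\<And>x. a \<le> x \<Longrightarrow> x \<le> b \<Longrightarrow>
      (x - c) * indicator {t..} x \<le> \<alpha> * (x - \<mu>) + \<beta> * (\<bar>x - \<mu>\<bar> - d)"
  shows "cond_expectation_ge P t \<le> c"
proof -
  interpret real_distribution P using P by (simp add: mean_mad_set_def)
  note [simp] = mean_mad_set_integrable[OF P]
  have mean: "(\<integral>x. x \<partial>P) = \<mu>" and mad: "(\<integral>x. \<bar>x - \<mu>\<bar> \<partial>P) = d"
    using P by (simp_all add: mean_mad_set_def)
  have int1: "integrable P (\<lambda>x. x * indicator {t..} x)"
    by (rule integrable_real_mult_indicator) simp_all
  have int2: "integrable P (\<lambda>x. c * indicator {t..} x :: real)"
    by (simp add: less_top[symmetric])
  have "(\<integral>x. x * indicator {t..} x \<partial>P) - c * measure P {t..}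
      = (\<integral>x. x * indicator {t..} x - c * indicator {t..} x \<partial>P)"
    using int1 int2 by (subst Bochner_Integration.integral_diff) simp_all
  also have "\<dots> \<le> (\<integral>x. \<alpha> * (x - \<mu>) + \<beta> * (\<bar>x - \<mu>\<bar> - d) \<partial>P)"
  proof (rule integral_mono_AE)
    show "AE x in P. x * indicator {t..} x - c * indicator {t..} x
        \<le> \<alpha> * (x - \<mu>) + \<beta> * (\<bar>x - \<mu>\<bar> - d)"
      using mean_mad_set_AE[OF P]
      by eventually_elim (use dual in \<open>simp add: left_diff_distrib\<close>)
    show "integrable P (\<lambda>x. x * indicator {t..} x - c * indicator {t..} x)"
      using int1 int2 by (rule Bochner_Integration.integrable_diff)
  qed simp
  also have "\<dots> = 0"
    by (simp add: mean mad prob_space[simplified])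
  finally show ?thesis
    using pos by (simp add: cond_expectation_ge_def divide_le_eq)
qed

definition upper_atom :: "real \<Rightarrow> real \<Rightarrow> real \<Rightarrow> real" where
  "upper_atom \<mu> d p = \<mu> + d * (\<mu> - p) / (2 * (\<mu> - p) - d)"

text \<open>
  The multipliers \<open>\<alpha> = 1 - \<beta>\<close> and \<open>\<beta>\<close> make the right-hand side equal to \<open>x - v\<close> for \<open>x \<ge> \<mu>\<close> (slope
  \<open>\<alpha> + \<beta> = 1\<close>, root at \<open>v = upper_atom \<mu> d t\<close>), and linear with root \<open>t\<close> and negative slope
  \<open>\<alpha> - \<beta>\<close> for \<open>x \<le> \<mu>\<close>. It therefore touches the left-hand side at the two atoms of the
  limiting extremal law: at \<open>v\<close>, and at \<open>t\<close> approached from below. On \<open>[t, \<mu>]\<close> it meets \<open>x - v\<close>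
  at \<open>\<mu>\<close> and has the smaller slope, hence lies above it.
\<close>

lemma upper_atom_dual_certificate:
  fixes x t \<mu> d :: real
  assumes "d > 0" and den: "2 * (\<mu> - t) - d > 0"
  defines "\<beta> \<equiv> (\<mu> - t) / (2 * (\<mu> - t) - d)"
  shows "(x - upper_atom \<mu> d t) * indicator {t..} x \<le> (1 - \<beta>) * (x - \<mu>) + \<beta> * (\<bar>x - \<mu>\<bar> - d)"
proof -
  have v: "upper_atom \<mu> d t = \<mu> + \<beta> * d" by (simp add: upper_atom_def \<beta>_def)
  have slope: "2 * \<beta> - 1 = d / (2 * (\<mu> - t) - d)"
    using den by (simp add: \<beta>_def field_simps)
  have slope_pos: "2 * \<beta> - 1 > 0" unfolding slope using assms(1) den by simp
  have root: "(2 * \<beta> - 1) * (\<mu> - t) = \<beta> * d"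
    unfolding slope by (simp add: \<beta>_def)
  consider "x \<ge> \<mu>" | "t \<le> x" "x < \<mu>" | "x < t" by linarith
  then show ?thesis
  proof cases
    case 1
    then show ?thesis using den assms(1) by (simp add: v algebra_simps indicator_def)
  next
    case 2
    have "0 \<le> 2 * \<beta> * (\<mu> - x)" using slope_pos 2 by simp
    then show ?thesis using 2 by (simp add: v algebra_simps)
  next
    case 3
    have "(2 * \<beta> - 1) * (\<mu> - t) \<le> (2 * \<beta> - 1) * (\<mu> - x)"
      using slope_pos 3 by (intro mult_left_mono) auto
    then have "0 \<le> (2 * \<beta> - 1) * (\<mu> - x) - \<beta> * d" unfolding root by simp
    moreover have "x < \<mu>" using 3 den assms(1) by simp
    ultimately show ?thesis using 3 by (simp add: algebra_simps)
  qed
qed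

section \<open>Two-point laws\<close>

definition two_point_law :: "real \<Rightarrow> real \<Rightarrow> real \<Rightarrow> real measure" where
  "two_point_law q u v = distr (measure_pmf (bernoulli_pmf q)) borel (\<lambda>h. if h then v else u)"

lemma real_distribution_two_point_law: "real_distribution (two_point_law q u v)"
  unfolding two_point_law_def
  by (rule prob_space.real_distribution_distr) (simp_all add: measure_pmf.prob_space_axioms)

lemma integral_two_point_law:
  fixes f :: "real \<Rightarrow> real"
  assumes "0 \<le> q" "q \<le> 1" and [measurable]: "f \<in> borel_measurable borel"
  shows "(\<integral>x. f x \<partial>two_point_law q u v) = q * f v + (1 - q) * f u"
  unfolding two_point_law_def using assms(1,2)
  by (subst integral_distr) simp_all

lemma measure_two_point_law:
  assumes "0 \<le> q" "q \<le> 1" and [measurable]: "A \<in> sets borel"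
  shows "measure (two_point_law q u v) A = q * indicator A v + (1 - q) * indicator A u"
proof -
  interpret real_distribution "two_point_law q u v" by (rule real_distribution_two_point_law)
  have "measure (two_point_law q u v) A = (\<integral>x. indicator A x \<partial>two_point_law q u v)"
    by simp
  also have "\<dots> = q * indicator A v + (1 - q) * indicator A u"
    by (rule integral_two_point_law) (use assms in simp_all)
  finally show ?thesis .
qed

text \<open>
  The hypothesis \<open>feasible\<close> is the inequality of \<open>mad_le_chord\<close> for the interval \<open>[p, b]\<close>; it says
  exactly that the formula for the upper atom belonging to \<open>p\<close> has a positive denominator and
  yields a point not beyond \<open>b\<close>.
\<close>

lemma upper_atom_bounds:
  fixes b \<mu> d p :: real
  assumes "p < \<mu>" "\<mu> < b" "d > 0" and feasible: "d * (b - p) \<le> 2 * (\<mu> - p) * (b - \<mu>)"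
  shows "2 * (\<mu> - p) - d > 0" and "\<mu> < upper_atom \<mu> d p" and "upper_atom \<mu> d p \<le> b"
proof -
  have "0 < d * (\<mu> - p)" using assms by simp
  also have "\<dots> \<le> (2 * (\<mu> - p) - d) * (b - \<mu>)" using feasible by (simp add: algebra_simps)
  finally show den: "2 * (\<mu> - p) - d > 0" using assms(2) by (simp add: zero_less_mult_iff)
  then show "\<mu> < upper_atom \<mu> d p" using assms by (simp add: upper_atom_def)
  have "d * (\<mu> - p) / (2 * (\<mu> - p) - d) \<le> b - \<mu>"
    unfolding pos_divide_le_eq[OF den] using feasible by (simp add: algebra_simps)
  then show "upper_atom \<mu> d p \<le> b" by (simp add: upper_atom_def)
qed

text \<open>
  Each atom has to contribute \<open>d / 2\<close> to the mean absolute deviation, which forces the weight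
  \<open>d / (2 (\<mu> - p))\<close> on the lower atom \<open>p\<close>.
\<close>

lemma upper_atom_attained:
  fixes a b \<mu> d p t :: real
  assumes "a \<le> p" "p < \<mu>" "\<mu> < b" "d > 0"
    and feasible: "d * (b - p) \<le> 2 * (\<mu> - p) * (b - \<mu>)"
    and t: "p < t" "t \<le> upper_atom \<mu> d p"
  obtains P where "P \<in> mean_mad_set a b \<mu> d" "measure P {t..} > 0"
    "cond_expectation_ge P t = upper_atom \<mu> d p"
proof -
  define v where "v = upper_atom \<mu> d p"
  define q where "q = 1 - d / (2 * (\<mu> - p))"
  let ?P = "two_point_law q p v"
  note bounds = upper_atom_bounds[OF assms(2-5), folded v_def]
  have q: "0 < q" "q \<le> 1" using bounds(1) assms by (simp_all add: q_def field_simps)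
  have "1 - q = d / 2 / (\<mu> - p)" by (simp add: q_def)
  then have low: "(1 - q) * (\<mu> - p) = d / 2"
    using assms(2) by (metis nonzero_eq_divide_eq right_minus_eq less_irrefl)
  have up: "q * (v - \<mu>) = d / 2"
  proof -
    define c where "c = 2 * (\<mu> - p) - d"
    have "q * (v - \<mu>) = d * (q * (\<mu> - p)) / c"
      by (simp add: v_def upper_atom_def c_def)
    also have "q * (\<mu> - p) = c / 2" using low by (simp add: c_def algebra_simps)
    also have "d * (c / 2) / c = d / 2" using bounds(1)[folded c_def] by simp
    finally show ?thesis .
  qed
  have "(\<integral>x. x \<partial>?P) = \<mu> + q * (v - \<mu>) - (1 - q) * (\<mu> - p)"
    using q by (subst integral_two_point_law) (simp_all add: algebra_simps)
  then have mean: "(\<integral>x. x \<partial>?P) = \<mu>" by (simp add: low up)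
  have "(\<integral>x. \<bar>x - \<mu>\<bar> \<partial>?P) = q * (v - \<mu>) + (1 - q) * (\<mu> - p)"
    using q bounds(2) assms(2) by (subst integral_two_point_law) simp_all
  then have mad: "(\<integral>x. \<bar>x - \<mu>\<bar> \<partial>?P) = d" by (simp add: low up)
  have "measure ?P {a..b} = 1"
    using q bounds assms by (simp add: measure_two_point_law)
  then have mem: "?P \<in> mean_mad_set a b \<mu> d"
    by (simp add: mean_mad_set_def real_distribution_two_point_law mean mad)
  have tail: "measure ?P {t..} = q"
    using q t by (simp add: measure_two_point_law v_def)
  have "(\<integral>x. x * indicator {t..} x \<partial>?P) = q * v"
    using q t by (subst integral_two_point_law) (simp_all add: v_def)
  then have "cond_expectation_ge ?P t = v"
    using q by (simp add: cond_expectation_ge_def tail)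
  then show ?thesis using that[OF mem] tail q by (simp add: v_def)
qed

section \<open>The supremum\<close>

theorem proposition2:
  fixes a b \<mu> d t :: real
  assumes "a < \<mu>" and "\<mu> < b" and "d > 0"
    and "mean_mad_set a b \<mu> d \<noteq> {}"
    and "a < t" and "t \<le> b"
  shows "(SUP P \<in> {P \<in> mean_mad_set a b \<mu> d. measure P {t..} > 0}.
            ereal (cond_expectation_ge P t)) =
         ereal (if t < \<mu> - d * (b - \<mu>) / (2 * (b - \<mu>) - d)
                then \<mu> + d * (\<mu> - t) / (2 * (\<mu> - t) - d)
                else b)"
proof -
  define T where "T = \<mu> - d * (b - \<mu>) / (2 * (b - \<mu>) - d)"
  let ?v = "upper_atom \<mu> d"
  let ?S = "SUP P \<in> {P \<in> mean_mad_set a b \<mu> d. measure P {t..} > 0}.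
              ereal (cond_expectation_ge P t)"
  have chord: "d * (b - a) \<le> 2 * (\<mu> - a) * (b - \<mu>)"
    using mad_le_chord assms by blast
  have "0 < d * (b - \<mu>)" using assms by simp
  also have "\<dots> \<le> (2 * (b - \<mu>) - d) * (\<mu> - a)" using chord by (simp add: algebra_simps)
  finally have B: "2 * (b - \<mu>) - d > 0" using assms(1) by (simp add: zero_less_mult_iff)
  have T_mu: "T < \<mu>" using B assms by (simp add: T_def)
  have T_a: "a \<le> T"
  proof -
    have "d * (b - \<mu>) / (2 * (b - \<mu>) - d) \<le> \<mu> - a"
      unfolding pos_divide_le_eq[OF B] using chord by (simp add: algebra_simps)
    then show ?thesis by (simp add: T_def)
  qed
  have T_eq: "d * (b - T) = 2 * (\<mu> - T) * (b - \<mu>)"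
  proof -
    have "(\<mu> - T) * (2 * (b - \<mu>) - d) = d * (b - \<mu>)" using B by (simp add: T_def)
    then show ?thesis by (simp add: algebra_simps)
  qed
  have feasible: "d * (b - p) \<le> 2 * (\<mu> - p) * (b - \<mu>)" if "p \<le> T" for p
  proof -
    have "0 \<le> (T - p) * (2 * (b - \<mu>) - d)" using B that by simp
    then show ?thesis using T_eq by (simp add: algebra_simps)
  qed
  have v_T: "?v T = b"
  proof -
    have "2 * (\<mu> - T) - d > 0"
      using upper_atom_bounds(1)[OF T_mu] assms feasible by blast
    moreover have "d * (\<mu> - T) = (b - \<mu>) * (2 * (\<mu> - T) - d)"
      using T_eq by (simp add: algebra_simps)
    ultimately show ?thesis by (simp add: upper_atom_def)
  qed
  have lower: "ereal (?v p) \<le> ?S" if p: "a \<le> p" "p \<le> T" "p < t" "t \<le> ?v p" for p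
  proof -
    have "p < \<mu>" using p T_mu by simp
    then obtain P where "P \<in> mean_mad_set a b \<mu> d" "measure P {t..} > 0"
      "cond_expectation_ge P t = ?v p"
      using upper_atom_attained[of a p \<mu> b d t] p assms feasible by blast
    then show ?thesis by (intro SUP_upper2[of P]) auto
  qed
  have lower_limit: "ereal (?v t) \<le> ?S" if "t \<le> T"
  proof (rule tendsto_upperbound)
    have "2 * (\<mu> - t) - d \<noteq> 0"
      using upper_atom_bounds(1)[of t \<mu> b d] that T_mu assms feasible by fastforce
    then show "((\<lambda>p. ereal (?v p)) \<longlongrightarrow> ereal (?v t)) (at_left t)"
      unfolding upper_atom_def by (intro tendsto_intros) auto
    have "\<forall>\<^sub>F p in at_left t. p \<in> {a<..<t}"
      using assms(5) by (rule eventually_at_left_real)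
    then show "\<forall>\<^sub>F p in at_left t. ereal (?v p) \<le> ?S"
    proof eventually_elim
      case (elim p)
      have "\<mu> < ?v p"
        using upper_atom_bounds(2)[of p \<mu> b d] elim that T_mu assms feasible by fastforce
      then show ?case using elim that T_mu by (intro lower) auto
    qed
  qed simp
  have upper_b: "?S \<le> ereal b"
  proof (rule SUP_least)
    fix P assume "P \<in> {P \<in> mean_mad_set a b \<mu> d. measure P {t..} > 0}"
    then have "cond_expectation_ge P t \<le> b"
      by (intro cond_expectation_ge_dual_bound[where \<alpha> = 0 and \<beta> = 0]) (auto simp: indicator_def)
    then show "ereal (cond_expectation_ge P t) \<le> ereal b" by simp
  qed
  have upper_v: "?S \<le> ereal (?v t)" if "t < T"
  proof (rule SUP_least)
    fix P assume P: "P \<in> {P \<in> mean_mad_set a b \<mu> d. measure P {t..} > 0}"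
    have den: "2 * (\<mu> - t) - d > 0"
      using upper_atom_bounds(1)[of t \<mu> b d] that T_mu assms feasible by fastforce
    have "cond_expectation_ge P t \<le> ?v t"
      using P cond_expectation_ge_dual_bound[OF _ _ upper_atom_dual_certificate[OF assms(3) den]]
      by blast
    then show "ereal (cond_expectation_ge P t) \<le> ereal (?v t)" by simp
  qed
  have "?S = ereal (if t < T then ?v t else b)"
  proof (cases "t < T")
    case True
    then show ?thesis using lower_limit upper_v by (auto intro: antisym)
  next
    case False
    have "ereal b \<le> ?S"
    proof (cases "t = T")
      case True
      then show ?thesis using lower_limit v_T by simp
    next
      case neq: False
      then show ?thesis using lower[of T] False T_a v_T assms(6) by simp
    qed
    then show ?thesis using False upper_b by (auto intro: antisym)
  qed
  then show ?thesis by (simp only: T_def upper_atom_def)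
qed

end
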